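(* Let $K$ be a closed convex cone in $\mathbb{R}^s$ with a nonempty interior, and let a mapping $P:\mathbb{R}^n\times K\to\mathbb{R}^m$ be strictly differentiable at $(0,0)$. Then $P$ can be extended to a mapping $\widetilde P:\mathbb{R}^n\times\mathbb{R}^s\to\mathbb{R}^m$ (that is, $\widetilde P=P$ on $\mathbb{R}^n\times K$) which is still strictly differentiable at $(0,0)$.
   Context: Let $D\subset\mathbb{R}^n\times\mathbb{R}^s$ be a set containing $(0,0)$ (here $D=\mathbb{R}^n\times K$ or $D=\mathbb{R}^n\times\mathbb{R}^s$). A mapping $P:D\to\mathbb{R}^m$ is strictly differentiable at $(0,0)$ if there is a linear operator $P'(0,0):\mathbb{R}^n\times\mathbb{R}^s\to\mathbb{R}^m$ such that the difference $z\mapsto P(z)-P'(0,0)z$ is Lipschitz continuous on the intersection of $D$ with the $r$-neighborhood of $(0,0)$, for all sufficiently small $r>0$, with a constant $\mu(r)\to0$ as $r\to0$. *)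

theory Defs
  imports "HOL-Analysis.Analysis"
begin

text \<open>
  A partial map on \<open>D\<close> is represented by a total function; only its values on \<open>D\<close> matter here.
  The \<open>lipschitz_on\<close> predicate includes nonnegativity of the constant \<open>\<mu> r\<close>.
\<close>

definition strictly_differentiable_at_zero ::
    "'a::euclidean_space set \<Rightarrow> ('a \<Rightarrow> 'b::euclidean_space) \<Rightarrow> bool" where
  "strictly_differentiable_at_zero D P \<longleftrightarrow>
     (\<exists>L \<mu>. linear L \<and> (\<mu> \<longlongrightarrow> 0) (at_right (0::real)) \<and>
        (\<exists>r\<^sub>0>0. \<forall>r. 0 < r \<and> r < r\<^sub>0 \<longrightarrow> (\<mu> r)-lipschitz_on (D \<inter> ball 0 r) (\<lambda>z. P z - L z)))"

end

(* The metric projection onto a closed convex set D is 1-Lipschitz and fixes the points of D.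
   If D contains 0, it fixes 0 and hence maps every ball around 0 into itself. So, with L the
   derivative of P at 0, composing the remainder P - L with the projection keeps its Lipschitz
   constant on each ball. *)
theory Submission
  imports Defs
begin

lemma lipschitz_on_closest_point:
  fixes D :: "'a::euclidean_space set"
  assumes "closed D" "convex D" "D \<noteq> {}"
  shows "1-lipschitz_on X (closest_point D)"
  using closest_point_lipschitz[OF assms(2,1,3)] by (intro lipschitz_onI) auto

lemma norm_closest_point_le:
  fixes D :: "'a::euclidean_space set"
  assumes "closed D" "convex D" "0 \<in> D"
  shows "norm (closest_point D z) \<le> norm z"
  using closest_point_lipschitz[of D z 0] assms closest_point_self[of 0 D] by auto

text \<open>Stated for a general \<open>D\<close> so that the product \<open>UNIV \<times> K\<close>
  can be projected onto as one convex set.\<close>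

lemma strictly_differentiable_at_zero_extension:
  fixes P :: "'a::euclidean_space \<Rightarrow> 'b::euclidean_space"
  assumes D: "closed D" "convex D" "0 \<in> D"
    and P: "strictly_differentiable_at_zero D P"
  shows "\<exists>P'. (\<forall>z\<in>D. P' z = P z) \<and> strictly_differentiable_at_zero UNIV P'"
proof -
  obtain L \<mu> r\<^sub>0 where L: "linear L" and \<mu>: "(\<mu> \<longlongrightarrow> 0) (at_right (0::real))" and "r\<^sub>0 > 0"
    and lip: "\<And>r. 0 < r \<Longrightarrow> r < r\<^sub>0 \<Longrightarrow> (\<mu> r)-lipschitz_on (D \<inter> ball 0 r) (\<lambda>z. P z - L z)"
    using P unfolding strictly_differentiable_at_zero_def by blast
  have ne: "D \<noteq> {}" using D by blast
  \<comment> \<open>Only the remainder is projected; \<open>L z\<close> stays as it is, since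
    \<open>L\<close> composed with the projection need not be linear.\<close>
  define P' where "P' z = L z + (P (closest_point D z) - L (closest_point D z))" for z
  have "(\<mu> r)-lipschitz_on (UNIV \<inter> ball 0 r) (\<lambda>z. P' z - L z)" if r: "0 < r" "r < r\<^sub>0" for r
  proof -
    \<comment> \<open>The radius does not grow, so the bound \<open>\<mu> r\<close> for
      \<open>P - L\<close> applies on the image.\<close>
    have "closest_point D ` ball 0 r \<subseteq> D \<inter> ball 0 r"
      using closest_point_in_set[OF D(1) ne]
      by (auto intro: le_less_trans[OF norm_closest_point_le[OF D]])
    then have "(\<mu> r)-lipschitz_on (closest_point D ` ball 0 r) (\<lambda>z. P z - L z)"
      by (rule lipschitz_on_subset[OF lip[OF r]])
    \<comment> \<open>The composite has constant \<open>\<mu> r * 1\<close>, so \<open>L\<close>,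
      \<open>\<mu>\<close> and \<open>r\<^sub>0\<close> all serve again for
      \<open>P'\<close>.\<close>
    from lipschitz_on_compose2[OF lipschitz_on_closest_point[OF D(1,2) ne] this]
    show ?thesis by (simp add: P'_def)
  qed
  then have "strictly_differentiable_at_zero UNIV P'"
    unfolding strictly_differentiable_at_zero_def using L \<mu> \<open>r\<^sub>0 > 0\<close> by blast
  \<comment> \<open>On \<open>D\<close> the projection is the identity and the two \<open>L\<close>
    terms cancel.\<close>
  moreover have "\<forall>z\<in>D. P' z = P z"
    by (simp add: P'_def closest_point_self)
  ultimately show ?thesis by blast
qed

theorem lemma5:
  fixes K :: "(real ^ 's) set"
    and P :: "(real ^ 'n) \<times> (real ^ 's) \<Rightarrow> real ^ 'm"
  assumes "closed K" and "convex K" and "cone K" and "interior K \<noteq> {}"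
    and "strictly_differentiable_at_zero (UNIV \<times> K) P"
  shows "\<exists>P' :: (real ^ 'n) \<times> (real ^ 's) \<Rightarrow> real ^ 'm.
           (\<forall>z \<in> UNIV \<times> K. P' z = P z) \<and> strictly_differentiable_at_zero UNIV P'"
proof (rule strictly_differentiable_at_zero_extension)
  show "closed ((UNIV :: (real ^ 'n) set) \<times> K)"
    using assms(1) by (simp add: closed_Times)
  show "convex ((UNIV :: (real ^ 'n) set) \<times> K)"
    using assms(2) by (simp add: convex_Times)
  \<comment> \<open>Scaling any point of the cone by 0 puts the origin in \<open>K\<close>.\<close>
  have "K \<noteq> {}" using assms(4) by auto
  then show "0 \<in> (UNIV :: (real ^ 'n) set) \<times> K"
    using assms(3) cone_contains_0 by (auto simp: zero_prod_def)
qed (rule assms(5))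

end
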